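(* For every natural number $n$ that is a power of a prime, there exists a regular, geodetic, Hamiltonian graph of diameter $4$ with $(n+1)^3+1$ vertices.
   Context: A geodesic is a shortest path between two vertices; a graph is geodetic if between any two of its vertices there is exactly one geodesic. A graph is Hamiltonian if it has a cycle through all its vertices. *)

theory Defs
  imports "Graph_Theory.Graph_Theory" "HOL-Number_Theory.Prime_Powers"
begin

text \<open>
  A finite simple undirected graph is a \<^locale>\<open>pair_graph\<close>: a finite, loop-free, symmetric digraph
  whose arcs are pairs of vertices, each edge \<open>{u, v}\<close> being the two arcs \<open>(u, v)\<close> and \<open>(v, u)\<close>.
  Arc walks then correspond one-to-one to walks given by their vertex sequences, and the degree
  of a vertex is its out-degree.
\<close>

definition geodesic :: "('a, 'b) pre_digraph \<Rightarrow> 'a \<Rightarrow> 'b awalk \<Rightarrow> 'a \<Rightarrow> bool" where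
  "geodesic G u p v \<longleftrightarrow>
     pre_digraph.apath G u p v \<and> (\<forall>q. pre_digraph.apath G u q v \<longrightarrow> length p \<le> length q)"

definition geodetic_graph :: "('a, 'b) pre_digraph \<Rightarrow> bool" where
  "geodetic_graph G \<longleftrightarrow> (\<forall>u\<in>verts G. \<forall>v\<in>verts G. \<exists>!p. geodesic G u p v)"

definition regular_graph :: "('a, 'b) pre_digraph \<Rightarrow> bool" where
  "regular_graph G \<longleftrightarrow> (\<exists>k. \<forall>v\<in>verts G. out_degree G v = k)"

text \<open>
  The condition \<open>3 \<le> length p\<close> is needed because \<^const>\<open>pre_digraph.cycle\<close> also admits
  the closed walks \<open>(u, v), (v, u)\<close>, which are not cycles of the undirected graph.
\<close>

definition hamiltonian_graph :: "('a, 'b) pre_digraph \<Rightarrow> bool" where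
  "hamiltonian_graph G \<longleftrightarrow>
     (\<exists>u p. pre_digraph.awalk G u p u \<and> pre_digraph.cycle G p \<and> 3 \<le> length p \<and>
        set (pre_digraph.awalk_verts G u p) = verts G)"

text \<open>
  With unit arc weights \<^const>\<open>wf_digraph.\<mu>\<close> is the distance function; it is \<open>\<infinity>\<close> between vertices
  that are not joined by a walk, so a disconnected graph has infinite diameter.
\<close>

definition graph_diameter :: "('a, 'b) pre_digraph \<Rightarrow> ereal" where
  "graph_diameter G = (SUP u\<in>verts G. SUP v\<in>verts G. wf_digraph.\<mu> G (\<lambda>_. 1) u v)"

end

theory Submission
  imports Defs "HOL-Algebra.Algebraic_Closure" "HOL-Number_Theory.Residues"
begin

text \<open>
  Take a projective plane of order \<open>n\<close> and replace every line in its incidence graph by a complete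
  graph on the \<open>n + 1\<close> flags of that line: the vertices are the points and the flags, a point is
  joined to its flags, and two flags are joined if they have the same line. All degrees are
  \<open>n + 1\<close>, there are \<open>(n\<^sup>2 + n + 1) (n + 2) = (n + 1)\<^sup>3 + 1\<close> vertices, and since two points have
  exactly one common line and two lines exactly one common point, from every vertex exactly one
  neighbour is closer to a given target. A Hamiltonian cycle of the incidence graph yields one of
  the new graph, by running through all flags of a line on the way between two points. For the
  plane over a finite field such a cycle exists because multiplication by a generator of the field
  with \<open>n\<^sup>3\<close> elements permutes the points cyclically (Singer).
\<close>

hide_const (open) Divisibility.prime

section \<open>Finite fields\<close>

lemma (in cring) binomial_expansion:
  assumes [simp]: "x \<in> carrier R" "y \<in> carrier R"
  shows "(x \<oplus> y) [^] (n::nat) = (\<Oplus>i\<in>{..n}. add_pow R (n choose i) (x [^] i \<otimes> y [^] (n - i)))"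
proof (induction n)
  case 0
  show ?case by simp
next
  case (Suc n)
  let ?f = "\<lambda>i. add_pow R (n choose i) (x [^] i \<otimes> y [^] (n - i))"
  let ?g = "\<lambda>i. add_pow R (n choose i) (x [^] i \<otimes> y [^] (Suc n - i))"
  let ?h = "\<lambda>i. add_pow R (n choose i) (x [^] Suc i \<otimes> y [^] (n - i))"
  have c: "?f \<in> A \<rightarrow> carrier R" "?g \<in> A \<rightarrow> carrier R" "?h \<in> A \<rightarrow> carrier R" for A
    by auto
  have fx: "?f i \<otimes> x = ?h i" for i
    by (subst add_pow_ldistr) (auto simp: m_ac)
  have sx: "(\<Oplus>i\<in>{..n}. ?f i) \<otimes> x = (\<Oplus>i\<in>{..n}. ?h i)"
    by (subst finsum_ldistr) (auto intro!: finsum_cong' simp: fx simp del: nat_pow_Suc)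
  have gy: "?f i \<otimes> y = ?g i" if "i \<le> n" for i
    using that by (simp add: add_pow_ldistr m_assoc Suc_diff_le)
  have sy: "(\<Oplus>i\<in>{..n}. ?f i) \<otimes> y = (\<Oplus>i\<in>{..n}. ?g i)"
    by (subst finsum_ldistr) (auto intro!: finsum_cong' simp: gy simp del: nat_pow_Suc)
  have "(\<Oplus>i\<in>{..n}. ?g i) = (\<Oplus>i\<in>{..Suc n}. ?g i)"
    using c by (subst finsum_Suc) (auto simp: binomial_eq_0)
  also have "\<dots> = (\<Oplus>i\<in>{..n}. ?g (Suc i)) \<oplus> ?g 0"
    using c by (subst finsum_Suc2) auto
  finally have g: "(\<Oplus>i\<in>{..n}. ?g i) = (\<Oplus>i\<in>{..n}. ?g (Suc i)) \<oplus> ?g 0" .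
  have "(\<Oplus>i\<in>{..Suc n}. add_pow R (Suc n choose i) (x [^] i \<otimes> y [^] (Suc n - i)))
      = (\<Oplus>i\<in>{..n}. ?h i \<oplus> ?g (Suc i)) \<oplus> ?g 0"
    by (subst finsum_Suc2) (auto intro!: finsum_cong' arg_cong2[of _ _ _ _ "(\<oplus>)"]
        simp: add.nat_pow_mult simp del: nat_pow_Suc)
  also have "\<dots> = (\<Oplus>i\<in>{..n}. ?h i) \<oplus> ((\<Oplus>i\<in>{..n}. ?g (Suc i)) \<oplus> ?g 0)"
    by (subst finsum_addf) (auto simp: a_assoc simp del: nat_pow_Suc)
  also have "\<dots> = (\<Oplus>i\<in>{..n}. ?f i) \<otimes> x \<oplus> (\<Oplus>i\<in>{..n}. ?f i) \<otimes> y"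
    unfolding sx sy g ..
  also have "\<dots> = (x \<oplus> y) [^] Suc n"
    using Suc c by (simp add: r_distr)
  finally show ?case by simp
qed

lemma (in cring) add_pow_char_eq_zero:
  assumes "add_pow R p \<one> = \<zero>" "p dvd (n::nat)" "x \<in> carrier R"
  shows "add_pow R n x = \<zero>"
proof -
  obtain m where n: "n = p * m" using assms(2) by auto
  have "add_pow R p (add_pow R m x) = (add_pow R p \<one>) \<otimes> (add_pow R m x)"
    using assms(3) by (subst add_pow_ldistr) auto
  then show ?thesis
    using assms(1,3) by (simp add: n mult.commute add.nat_pow_pow)
qed

text \<open>All inner binomial coefficients \<open>p choose i\<close> are divisible by
  \<open>p\<close>, so only the two outer terms of the expansion survive.\<close>

lemma (in cring) frobenius_add:
  assumes p: "prime p" "add_pow R p \<one> = \<zero>" and [simp]: "x \<in> carrier R" "y \<in> carrier R"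
  shows "(x \<oplus> y) [^] (p::nat) = x [^] p \<oplus> y [^] p"
proof -
  let ?f = "\<lambda>i. add_pow R (p choose i) (x [^] i \<otimes> y [^] (p - i))"
  \<comment> \<open>The inner indices from 1 to \<open>p - 1\<close> are then exactly
    \<open>Suc i\<close> with \<open>i \<le> m\<close>.\<close>
  obtain m where m: "p = Suc (Suc m)"
    using le_Suc_ex[OF prime_ge_2_nat[OF p(1)]] by auto
  have "?f (Suc i) = \<zero>" if "i \<le> m" for i
    using that m p by (intro add_pow_char_eq_zero[OF p(2)] dvd_choose_prime) auto
  then have "(\<Oplus>i\<in>{..m}. ?f (Suc i)) = \<zero>"
    by (intro add.finprod_one_eqI) auto
  moreover have "(\<Oplus>i\<in>{..p}. ?f i) = ?f p \<oplus> ((\<Oplus>i\<in>{..m}. ?f (Suc i)) \<oplus> ?f 0)"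
    unfolding m by (subst finsum_Suc, simp, subst finsum_Suc2) auto
  ultimately show ?thesis
    by (simp add: binomial_expansion)
qed

lemma (in cring) frobenius_pow_add:
  assumes p: "prime p" "add_pow R p \<one> = \<zero>" and [simp]: "x \<in> carrier R" "y \<in> carrier R"
  shows "(x \<oplus> y) [^] (p ^ m :: nat) = x [^] (p ^ m) \<oplus> y [^] (p ^ m)"
proof (induction m)
  case (Suc m)
  show ?case
    unfolding power_Suc2 nat_pow_pow[symmetric, OF assms(3)] nat_pow_pow[symmetric, OF assms(4)]
      nat_pow_pow[symmetric, OF a_closed[OF assms(3,4)]] Suc
    by (rule frobenius_add[OF p]) auto
qed auto

text \<open>Additivity is applied to \<open>(x \<ominus> y) \<oplus> y\<close>, which avoids the
  sign of a power of -1 and hence a separate case for \<open>p = 2\<close>.\<close>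

lemma (in cring) frobenius_pow_diff:
  assumes p: "prime p" "add_pow R p \<one> = \<zero>" and [simp]: "x \<in> carrier R" "y \<in> carrier R"
  shows "(x \<ominus> y) [^] (p ^ m :: nat) = x [^] (p ^ m) \<ominus> y [^] (p ^ m)"
proof -
  have "x [^] (p ^ m) = ((x \<ominus> y) \<oplus> y) [^] (p ^ m)"
    by (simp add: minus_eq a_assoc l_neg)
  then show ?thesis
    by (simp add: frobenius_pow_add[OF p]) (simp add: minus_eq a_assoc r_neg)
qed

lemma (in ring_hom_ring) hom_add_pow:
  "x \<in> carrier R \<Longrightarrow> h (add_pow R (n::nat) x) = add_pow S n (h x)"
  by (induction n) auto




section \<open>Finite fields as fixed points of powers of the Frobenius map\<close>

lemma (in cring) minus_minus_cancel_right:
  assumes "x \<in> carrier R" "y \<in> carrier R" "z \<in> carrier R"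
  shows "(x \<ominus> z) \<ominus> (y \<ominus> z) = x \<ominus> y"
  using assms by algebra

lemma (in cring) minus_minus_self:
  assumes "x \<in> carrier R" "y \<in> carrier R"
  shows "x \<ominus> (x \<ominus> y) = y"
  using assms by algebra

text \<open>The fixed points are the roots of \<open>X^Q - X\<close> with \<open>Q = p ^ m\<close>.
  Over an algebraically closed field this polynomial has \<open>Q\<close> roots with multiplicity,
  so it remains to see that all of them are simple.\<close>

lemma (in algebraically_closed) card_frobenius_fixed_points:
  assumes p: "prime p" "add_pow L p \<one> = \<zero>" and m: "m > 0"
  shows "card {x \<in> carrier L. x [^] (p ^ m :: nat) = x} = p ^ m"
proof -
  let ?P = "poly_ring L"
  define Q where "Q = p ^ m"
  define f where "f = X [^]\<^bsub>?P\<^esub> Q \<ominus>\<^bsub>?P\<^esub> X"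
  have Q: "Q > 1"
    unfolding Q_def using prime_gt_1_nat[OF p(1)] m by (rule one_less_power)
  interpret UP: domain ?P
    using univ_poly_is_domain[OF carrier_is_subring] .
  interpret C: ring_hom_ring L ?P poly_of_const
    using canonical_embedding_ring_hom[OF carrier_is_subring] by simp
  have X[simp]: "X \<in> carrier ?P" "degree X = 1" and f[simp]: "f \<in> carrier ?P"
    using var_closed[OF carrier_is_subring] by (auto simp: f_def var_def)
  have d: "degree (X [^]\<^bsub>?P\<^esub> Q) = Q" "degree (\<ominus>\<^bsub>?P\<^esub> X) = 1"
    using X by (simp_all only: polynomial_pow_degree univ_poly_a_inv_degree[OF carrier_is_subring] mult_1_right)
  have "degree f = max (degree (X [^]\<^bsub>?P\<^esub> Q)) (degree (\<ominus>\<^bsub>?P\<^esub> X))"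
    unfolding f_def a_minus_def univ_poly_add using Q d
    by (intro poly_add_degree_eq[OF carrier_is_subring]) (auto simp: univ_poly_carrier)
  then have deg: "degree f = Q"
    using Q d by simp
  then have ne: "f \<noteq> []"
    using Q by auto
  have root: "is_root f a \<longleftrightarrow> a \<in> carrier L \<and> a [^] Q = a" for a
  proof (cases "a \<in> carrier L")
    case True
    interpret E: ring_hom_ring ?P L "\<lambda>p. eval p a"
      using eval_ring_hom[OF carrier_is_subring True] .
    have "eval f a = a [^] Q \<ominus> a"
      unfolding f_def a_minus_def using True
      by (simp add: E.hom_nat_pow eval_var del: eval.simps)
    then show ?thesis
      using True ne by (simp add: is_root_def)
  qed (simp add: is_root_def)
  \<comment> \<open>A multiple root \<open>a\<close> is impossible: the Frobenius map gives
    \<open>X\<^sup>Q - X = (X - a)\<^sup>Q - (X - a)\<close>, which is not divisible by \<open>(X - a)\<^sup>2\<close>.\<close>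
  have "alg_mult f a \<le> 1" for a
  proof (rule ccontr)
    assume *: "\<not> alg_mult f a \<le> 1"
    then have a: "a \<in> carrier L" "a [^] Q = a"
      using root alg_mult_gt_zero_iff_is_root[OF f, of a] by auto
    define l where "l = [\<one>, \<ominus> a]"
    have l: "l = X \<ominus>\<^bsub>?P\<^esub> poly_of_const a"
      unfolding l_def a_minus_def C.hom_a_inv[OF a(1), symmetric] using a
      by (cases "\<ominus> a = \<zero>") (auto simp: univ_poly_add var_def poly_of_const_def)
    have [simp]: "l \<in> carrier ?P"
      unfolding l using C.hom_closed[OF a(1)] by simp
    have [simp]: "l \<noteq> []" and dl: "degree l = 1"
      by (simp_all add: l_def)
    have "add_pow ?P p \<one>\<^bsub>?P\<^esub> = \<zero>\<^bsub>?P\<^esub>"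
      using C.hom_add_pow[of \<one> p] p(2) by simp
    then have "l [^]\<^bsub>?P\<^esub> Q = X [^]\<^bsub>?P\<^esub> Q \<ominus>\<^bsub>?P\<^esub> poly_of_const a"
      unfolding l Q_def using a p(1) C.hom_nat_pow[of a Q]
      by (subst UP.frobenius_pow_diff) (auto simp: Q_def)
    then have fl: "f = l [^]\<^bsub>?P\<^esub> Q \<ominus>\<^bsub>?P\<^esub> l"
      unfolding f_def using C.hom_closed[OF a(1)]
      by (simp add: l UP.minus_minus_cancel_right)
    have "l [^]\<^bsub>?P\<^esub> (2::nat) pdivides l [^]\<^bsub>?P\<^esub> Q"
      using Q by (intro polynomial_pow_division) auto
    then obtain r where r: "r \<in> carrier ?P"
      "l [^]\<^bsub>?P\<^esub> Q = l [^]\<^bsub>?P\<^esub> (2::nat) \<otimes>\<^bsub>?P\<^esub> r"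
      unfolding pdivides_def factor_def by blast
    have "l [^]\<^bsub>?P\<^esub> (2::nat) pdivides f"
      unfolding l_def using * by (intro le_alg_mult_imp_pdivides a f) auto
    then obtain s where s: "s \<in> carrier ?P"
      "f = l [^]\<^bsub>?P\<^esub> (2::nat) \<otimes>\<^bsub>?P\<^esub> s"
      unfolding pdivides_def factor_def by blast
    have "l = l [^]\<^bsub>?P\<^esub> Q \<ominus>\<^bsub>?P\<^esub> f"
      unfolding fl by (simp add: UP.minus_minus_self)
    also have "\<dots> = l [^]\<^bsub>?P\<^esub> (2::nat) \<otimes>\<^bsub>?P\<^esub> (r \<ominus>\<^bsub>?P\<^esub> s)"
      unfolding r(2) s(2) using r(1) s(1) by (simp add: a_minus_def UP.r_distr UP.r_minus)
    finally have "l [^]\<^bsub>?P\<^esub> (2::nat) pdivides l"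
      unfolding pdivides_def using r(1) s(1) by (intro dividesI[of "r \<ominus>\<^bsub>?P\<^esub> s"]) auto
    then have "degree (l [^]\<^bsub>?P\<^esub> (2::nat)) \<le> degree l"
      by (rule pdivides_imp_degree_le[OF carrier_is_subring, rotated -1]) simp_all
    moreover have "degree (l [^]\<^bsub>?P\<^esub> (2::nat)) = 2 * degree l"
      by (rule polynomial_pow_degree) simp
    ultimately show False
      using dl by linarith
  qed
  then have le: "count (roots f) a \<le> 1" for a
    using alg_mult_eq_count_roots[OF f] by simp
  have "count (roots f) a = (if a \<in># roots f then 1 else 0)" for a
    using le[of a] count_greater_zero_iff[of "roots f" a] count_eq_zero_iff[of "roots f" a]
    by (metis One_nat_def le_SucE le_zero_eq)
  then have "roots f = mset_set (set_mset (roots f))"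
    by (intro multiset_eqI) (simp add: count_mset_set')
  then have "card (set_mset (roots f)) = size (roots f)"
    by (metis size_mset_set)
  also have "size (roots f) = Q"
    using roots_over_carrier[OF f] deg by (simp add: splitted_def)
  also have "set_mset (roots f) = {x \<in> carrier L. x [^] (p ^ m) = x}"
    using roots_mem_iff_is_root[OF f] root by (auto simp: Q_def)
  finally show ?thesis by (simp add: Q_def)
qed


lemma (in algebraically_closed) frobenius_fixed_subfield:
  assumes p: "prime p" "add_pow L p \<one> = \<zero>"
  shows "subfield {x \<in> carrier L. x [^] (p ^ m :: nat) = x} L" (is "subfield ?K L")
proof (rule subfieldI')
  have pos: "p ^ m > 0"
    using prime_gt_0_nat[OF p(1)] by simp
  \<comment> \<open>Negation is read as \<open>\<zero> \<ominus> x\<close>; the exponent must be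
    positive for the power of zero to vanish.\<close>
  have neg: "\<ominus> x \<in> ?K" if "x \<in> ?K" for x
    using frobenius_pow_diff[OF p, of \<zero> x m] that pos by (simp add: nat_pow_zero a_minus_def)
  show "subring ?K L"
    using neg by (intro subringI) (auto simp: nat_pow_distrib frobenius_pow_add[OF p])
  fix x assume x: "x \<in> ?K - {\<zero>}"
  then have i: "inv x \<in> carrier L" "x \<otimes> inv x = \<one>"
    using field_Units by auto
  then have "x \<otimes> (inv x) [^] (p ^ m) = \<one>"
    using x nat_pow_distrib[of x "inv x" "p ^ m"] by simp
  then have "inv x = (inv x) [^] (p ^ m)"
    using x i by (intro comm_inv_char) auto
  then show "inv x \<in> ?K"
    using i by simp
qed

text \<open>The multiplicative group of a finite field is cyclic. Since \<open>g\<close> is a fixed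
  point, its powers have period \<open>p ^ m - 1\<close>, and that is the number of nonzero
  elements, so within one period no power repeats.\<close>

lemma (in algebraically_closed) frobenius_fixed_generator:
  fixes p m :: nat
  assumes p: "prime p" "add_pow L p \<one> = \<zero>" and m: "m > 0"
  defines "K \<equiv> {x \<in> carrier L. x [^] (p ^ m) = x}"
  obtains g where "g \<in> K" "g \<noteq> \<zero>" "g [^] (p ^ m - 1) = \<one>"
    "bij_betw (\<lambda>i. g [^] i) {..<p ^ m - 1} (K - {\<zero>})"
proof -
  let ?n = "p ^ m - 1"
  have card: "card K = p ^ m"
    unfolding K_def by (rule card_frobenius_fixed_points[OF p m])
  have Q: "p ^ m > 1"
    using prime_gt_1_nat[OF p(1)] m by (rule one_less_power)
  then have fin: "finite K"
    using card card.infinite by fastforce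
  interpret K: field "L\<lparr>carrier := K\<rparr>"
    unfolding K_def by (rule subfield_iff(2)[OF frobenius_fixed_subfield[OF p]])
  obtain g where g: "g \<in> K - {\<zero>}" "K - {\<zero>} = {g [^] i | i::nat. i \<in> UNIV}"
    using K.finite_field_mult_group_has_gen fin
    by (auto simp: mult_of_simps nat_pow_consistent[symmetric])
  have gL: "g \<in> carrier L" "g \<noteq> \<zero>" "g [^] (p ^ m) = g"
    using g(1) by (auto simp: K_def)
  have "g [^] ?n \<otimes> g = \<one> \<otimes> g"
    using gL Q by (metis Suc_diff_1 l_one nat_pow_Suc less_trans zero_less_one)
  then have one: "g [^] ?n = \<one>"
    using gL m_rcancel[of g "g [^] ?n" \<one>] by simp
  have "g [^] i = g [^] (i mod ?n)" for i
  proof -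
    have "g [^] i = g [^] (?n * (i div ?n) + i mod ?n)" by simp
    also have "\<dots> = g [^] (i mod ?n)"
      using gL one by (simp only: nat_pow_mult[symmetric] nat_pow_pow[symmetric]) simp
    finally show ?thesis .
  qed
  then have "K - {\<zero>} \<subseteq> (\<lambda>i. g [^] i) ` {..<?n}"
    unfolding g(2) using Q by fastforce
  moreover have "(\<lambda>i. g [^] i) ` {..<?n} \<subseteq> K - {\<zero>}"
    unfolding g(2) by auto
  ultimately have im: "(\<lambda>i. g [^] i) ` {..<?n} = K - {\<zero>}"
    by auto
  have "card (K - {\<zero>}) = ?n"
    using card K.zero_closed by simp
  then have "inj_on (\<lambda>i. g [^] i) {..<?n}"
    by (intro eq_card_imp_inj_on) (simp, simp only: im card_lessThan)
  then show ?thesis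
    using that[of g] g(1) gL one im by (simp add: bij_betw_def)
qed

text \<open>The algebraic closure of the residue field modulo \<open>p\<close>; the embedding of
  that field carries the characteristic over.\<close>

lemma exists_algebraically_closed_char:
  assumes "prime (p::nat)"
  obtains L :: "((int list \<times> nat) multiset \<Rightarrow> int) ring"
  where "algebraically_closed L" "add_pow L p \<one>\<^bsub>L\<^esub> = \<zero>\<^bsub>L\<^esub>"
proof -
  interpret R: residues_prime p "residue_ring (int p)"
    using assms by unfold_locales simp_all
  let ?R = "residue_ring (int p)"
  let ?L = R.alg_closure
  interpret L: algebraic_closure ?L "R.indexed_const ` (carrier ?R)"
    by (rule R.alg_closureE)
  interpret h: ring_hom_ring ?R ?L "R.indexed_const"
    by (intro ring_hom_ringI2 R.alg_closureE R.ring_axioms L.ring_axioms)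
  have "add_pow ?R n \<one>\<^bsub>?R\<^esub> = int n mod int p" for n :: nat
    by (induction n) (simp_all add: R.res_zero_eq R.res_one_eq R.res_add_eq mod_simps add.commute)
  then have "add_pow ?L p \<one>\<^bsub>?L\<^esub> = \<zero>\<^bsub>?L\<^esub>"
    using h.hom_add_pow[of "\<one>\<^bsub>?R\<^esub>" p] R.res_zero_eq h.hom_zero h.hom_one by simp
  then show ?thesis
    using that L.algebraically_closed_axioms by blast
qed

section \<open>Cyclic projective planes\<close>

lemma (in cring) minus_lin_comb:
  assumes "a \<in> carrier R" "b \<in> carrier R" "c \<in> carrier R" "d \<in> carrier R" "t \<in> carrier R"
  shows "(a \<oplus> b \<otimes> t) \<ominus> (c \<oplus> d \<otimes> t) = (a \<ominus> c) \<oplus> (b \<ominus> d) \<otimes> t"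
  using assms by algebra

text \<open>Turns a coincidence of two values of \<open>a \<oplus> t \<otimes> b\<close> into a
  multiple of \<open>t\<close>: used for the independence of 1 and \<open>t\<close> over
  \<open>F\<close>, and for a common vector of \<open>W\<close> and \<open>c W\<close>.\<close>

lemma (in cring) eq_add_mult_imp_diff:
  assumes "a \<in> carrier R" "b \<in> carrier R" "c \<in> carrier R" "d \<in> carrier R" "t \<in> carrier R"
    and "a \<oplus> t \<otimes> b = c \<oplus> t \<otimes> d"
  shows "a \<ominus> c = t \<otimes> (d \<ominus> b)"
proof -
  have "a \<ominus> c = (a \<oplus> t \<otimes> b) \<ominus> (c \<oplus> t \<otimes> b)"
    using assms(1-5) by algebra
  also have "\<dots> = t \<otimes> (d \<ominus> b)"
    unfolding assms(6) using assms(1-5) by algebra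
  finally show ?thesis .
qed

text \<open>Let \<open>K\<close> have \<open>q ^ 3\<close> elements and \<open>F\<close> be its
  subfield with \<open>q\<close> elements. The points of the plane are the nonzero elements of
  \<open>K\<close> up to factors from \<open>F\<close>, so they are the powers of a generator
  \<open>g\<close> with exponents modulo \<open>N\<close>. \<open>D\<close> holds the exponents of
  the points on one line \<open>W\<close>; as \<open>W\<close> meets its image under multiplication
  by \<open>g^d\<close>, the residue \<open>d\<close> is a difference of elements of
  \<open>D\<close>. An upper bound for \<open>card D\<close> is enough here, since equality follows
  later by counting.\<close>

lemma singer_covering:
  fixes p k :: nat
  assumes p: "prime p" and k: "k > 0"
  defines "q \<equiv> p ^ k"
  defines "N \<equiv> q\<^sup>2 + q + 1"
  obtains D where "D \<subseteq> {..<N}" "card D \<le> q + 1"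
    "\<And>d. \<exists>i\<in>D. \<exists>j\<in>D. i = (j + d) mod N"
proof -
  have q: "q > 1"
    unfolding q_def using prime_gt_1_nat[OF p] k by (rule one_less_power)
  have N: "N * (q - 1) = q ^ 3 - 1"
    using q by (simp add: N_def power3_eq_cube power2_eq_square algebra_simps diff_mult_distrib2)
  have q3: "q ^ 3 = p ^ (3 * k)"
    by (simp add: q_def power_mult[symmetric] mult.commute)
  obtain L :: "((int list \<times> nat) multiset \<Rightarrow> int) ring"
    where "algebraically_closed L" and p0: "add_pow L p \<one>\<^bsub>L\<^esub> = \<zero>\<^bsub>L\<^esub>"
    using exists_algebraically_closed_char[OF p] by blast
  then interpret algebraically_closed L by simp
  define K where "K = {x \<in> carrier L. x [^]\<^bsub>L\<^esub> (p ^ (3 * k)) = x}"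
  define F where "F = {x \<in> carrier L. x [^]\<^bsub>L\<^esub> (p ^ k) = x}"
  have cK: "card K = q ^ 3" and cF: "card F = q"
    using card_frobenius_fixed_points[OF p p0, of "3 * k"] card_frobenius_fixed_points[OF p p0 k] k
    by (simp_all add: K_def F_def q3) (simp add: q_def)
  have fin: "finite K" "finite F"
    using cK cF q card.infinite by fastforce+
  have sK: "subring K L" and sF: "subring F L"
    using frobenius_fixed_subfield[OF p p0] by (simp_all add: K_def F_def subfieldE(1))
  note K = subringE[OF sK] and F = subringE[OF sF]
  have FK: "F \<subseteq> K"
  proof
    fix x assume "x \<in> F"
    then have x: "x \<in> carrier L" "x [^]\<^bsub>L\<^esub> q = x" by (auto simp: F_def q_def)
    then have "((x [^]\<^bsub>L\<^esub> q) [^]\<^bsub>L\<^esub> q) [^]\<^bsub>L\<^esub> q = x" by simp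
    then have "x [^]\<^bsub>L\<^esub> (q ^ 3) = x"
      using x(1) by (simp only: nat_pow_pow power3_eq_cube mult.assoc)
    then show "x \<in> K" using x by (simp add: K_def q3)
  qed
  obtain g where g: "g \<in> K" "g \<noteq> \<zero>\<^bsub>L\<^esub>" "g [^]\<^bsub>L\<^esub> (q ^ 3 - 1) = \<one>\<^bsub>L\<^esub>"
    "bij_betw (\<lambda>i::nat. g [^]\<^bsub>L\<^esub> i) {..<q ^ 3 - 1} (K - {\<zero>\<^bsub>L\<^esub>})"
    using frobenius_fixed_generator[OF p p0, of "3 * k"] k unfolding K_def q3 by auto
  have gL[simp]: "g \<in> carrier L" using g K by blast
  have g_nz[simp]: "g [^]\<^bsub>L\<^esub> (i::nat) \<noteq> \<zero>\<^bsub>L\<^esub>" for i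
    using g(2) by (induction i) (auto simp: integral_iff)
  \<comment> \<open>Because \<open>N * (q - 1) = q ^ 3 - 1\<close>, raising a power of
    \<open>g^N\<close> to the power \<open>q\<close> does not change it. This is why exponents
    matter only modulo \<open>N\<close>.\<close>
  have gF: "g [^]\<^bsub>L\<^esub> (N * j) \<in> F" for j
  proof -
    have "N * j * q = N * (q - 1) * j + N * j"
      using q by (cases q) (simp_all add: algebra_simps)
    then have "N * j * q = (q ^ 3 - 1) * j + N * j"
      unfolding N .
    then have "(g [^]\<^bsub>L\<^esub> (N * j)) [^]\<^bsub>L\<^esub> q = (g [^]\<^bsub>L\<^esub> (q ^ 3 - 1)) [^]\<^bsub>L\<^esub> j \<otimes>\<^bsub>L\<^esub> g [^]\<^bsub>L\<^esub> (N * j)"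
      by (simp only: nat_pow_pow gL nat_pow_mult)
    then show ?thesis
      using g(3) by (simp add: F_def q_def)
  qed
  \<comment> \<open>Any element outside \<open>F\<close> is independent of 1 over \<open>F\<close>,
    so 1 and \<open>t\<close> span a plane with \<open>q^2\<close> vectors.\<close>
  obtain t where t: "t \<in> K" "t \<notin> F"
    using q fin cK cF FK by (metis subsetI subset_antisym power_one_right power_inject_exp numeral_eq_one_iff semiring_norm(86))
  \<comment> \<open>A line of the projective plane of \<open>K\<close> over \<open>F\<close>, as a two-dimensional subspace of \<open>K\<close>.\<close>
  define W where "W = (\<lambda>(a, b). a \<oplus>\<^bsub>L\<^esub> b \<otimes>\<^bsub>L\<^esub> t) ` (F \<times> F)"
  have tL[simp]: "t \<in> carrier L" using t K by blast
  have FL: "a \<in> F \<Longrightarrow> a \<in> carrier L" for a using F by blast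
  have Fdiff: "a \<ominus>\<^bsub>L\<^esub> b \<in> F" if "a \<in> F" "b \<in> F" for a b
    using that F by (simp add: a_minus_def)
  have WI: "a \<oplus>\<^bsub>L\<^esub> b \<otimes>\<^bsub>L\<^esub> t \<in> W" if "a \<in> F" "b \<in> F" for a b
    using that by (auto simp: W_def)
  have WE: "\<exists>a\<in>F. \<exists>b\<in>F. w = a \<oplus>\<^bsub>L\<^esub> b \<otimes>\<^bsub>L\<^esub> t" if "w \<in> W" for w
    using that by (auto simp: W_def)
  have WK: "W \<subseteq> K"
    using subsetD[OF FK] t by (auto simp: W_def intro!: K(6,7))
  have WL: "w \<in> W \<Longrightarrow> w \<in> carrier L" for w using WK K by blast
  have Wdiff: "v \<ominus>\<^bsub>L\<^esub> w \<in> W" if vw: "v \<in> W" "w \<in> W" for v w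
  proof -
    obtain a b c d where "a \<in> F" "b \<in> F" "c \<in> F" "d \<in> F"
      and "v = a \<oplus>\<^bsub>L\<^esub> b \<otimes>\<^bsub>L\<^esub> t" "w = c \<oplus>\<^bsub>L\<^esub> d \<otimes>\<^bsub>L\<^esub> t"
      using WE[OF vw(1)] WE[OF vw(2)] by blast
    then show ?thesis
      by (simp add: FL minus_lin_comb WI Fdiff)
  qed
  have Wmult: "c \<otimes>\<^bsub>L\<^esub> w \<in> W" if c: "c \<in> F" and w: "w \<in> W" for c w
  proof -
    obtain a b where "a \<in> F" "b \<in> F" "w = a \<oplus>\<^bsub>L\<^esub> b \<otimes>\<^bsub>L\<^esub> t"
      using WE[OF w] by blast
    with c show ?thesis
      using WI[of "c \<otimes>\<^bsub>L\<^esub> a" "c \<otimes>\<^bsub>L\<^esub> b"] F(6) by (simp add: FL r_distr m_assoc)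
  qed
  have "inj_on (\<lambda>(a, b). a \<oplus>\<^bsub>L\<^esub> b \<otimes>\<^bsub>L\<^esub> t) (F \<times> F)"
  proof (rule inj_onI, clarify)
    fix a b c d
    assume F4: "a \<in> F" "b \<in> F" "c \<in> F" "d \<in> F" and eq: "a \<oplus>\<^bsub>L\<^esub> b \<otimes>\<^bsub>L\<^esub> t = c \<oplus>\<^bsub>L\<^esub> d \<otimes>\<^bsub>L\<^esub> t"
    have eq': "a \<ominus>\<^bsub>L\<^esub> c = t \<otimes>\<^bsub>L\<^esub> (d \<ominus>\<^bsub>L\<^esub> b)"
      using eq F4 by (intro eq_add_mult_imp_diff) (simp_all add: FL m_comm)
    have "d = b"
    proof (rule ccontr)
      assume "d \<noteq> b"
      then have nz: "d \<ominus>\<^bsub>L\<^esub> b \<in> F - {\<zero>\<^bsub>L\<^esub>}"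
        using F4 FL Fdiff r_right_minus_eq by auto
      have "t \<in> F"
        using subfield_m_inv_simprule[OF frobenius_fixed_subfield[OF p p0], of "d \<ominus>\<^bsub>L\<^esub> b" k t]
          nz eq' F4 Fdiff[of a c] by (simp add: F_def[symmetric] m_comm FL)
      with t show False by simp
    qed
    moreover from this have "a \<ominus>\<^bsub>L\<^esub> c = \<zero>\<^bsub>L\<^esub>"
      using eq' FL[OF F4(2)] by (simp add: a_minus_def r_neg)
    ultimately show "a = c \<and> b = d"
      using F4 r_right_minus_eq[of a c] by (simp add: FL)
  qed
  then have cW: "card W = q\<^sup>2"
    by (simp add: W_def card_image card_cartesian_product cF power2_eq_square)
  have W0: "\<zero>\<^bsub>L\<^esub> \<in> W"
    using F(2) by (force simp: W_def)
  define D where "D = {i. i < N \<and> g [^]\<^bsub>L\<^esub> i \<in> W}"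
  \<comment> \<open>The scalar to multiply with is the inverse of
    \<open>g ^ (N * (i div N))\<close>; the factor \<open>q - 2\<close> writes it as a power with a
    natural exponent, because \<open>g ^ (N * (q - 1))\<close> is one.\<close>
  have memD: "i mod N \<in> D" if "g [^]\<^bsub>L\<^esub> i \<in> W" for i
  proof -
    have "N * ((q - 2) * (i div N)) + i = (q ^ 3 - 1) * (i div N) + i mod N"
    proof -
      obtain r where r: "q = r + 2" using q by (metis Suc_1 Suc_leI le_Suc_ex add.commute)
      have "N * ((q - 2) * (i div N)) + i = N * (r * (i div N)) + (N * (i div N) + i mod N)"
        using r by simp
      also have "\<dots> = (N * (q - 1)) * (i div N) + i mod N"
        using r by (simp add: algebra_simps)
      finally show ?thesis unfolding N .
    qed
    then have "g [^]\<^bsub>L\<^esub> (N * ((q - 2) * (i div N))) \<otimes>\<^bsub>L\<^esub> g [^]\<^bsub>L\<^esub> i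
        = (g [^]\<^bsub>L\<^esub> (q ^ 3 - 1)) [^]\<^bsub>L\<^esub> (i div N) \<otimes>\<^bsub>L\<^esub> g [^]\<^bsub>L\<^esub> (i mod N)"
      by (simp only: nat_pow_pow gL nat_pow_mult)
    then have "g [^]\<^bsub>L\<^esub> (i mod N) \<in> W"
      using Wmult[OF gF that, of "(q - 2) * (i div N)"] g(3) by simp
    then show ?thesis
      by (simp add: D_def N_def)
  qed
  \<comment> \<open>Each exponent in \<open>D\<close> accounts for \<open>q - 1\<close> vectors, its
    multiples by powers of \<open>g^N\<close>. All these are distinct nonzero vectors of
    \<open>W\<close>, which has only \<open>q^2 - 1\<close> of them.\<close>
  have "card D * (q - 1) \<le> (q + 1) * (q - 1)"
  proof -
    let ?h = "\<lambda>(i, j). g [^]\<^bsub>L\<^esub> (i + N * j)"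
    have "inj_on ?h (D \<times> {..<q - 1})"
    proof (rule inj_onI)
      fix x y
      assume xy: "x \<in> D \<times> {..<q - 1}" "y \<in> D \<times> {..<q - 1}" "?h x = ?h y"
      obtain i j i' j' where e: "x = (i, j)" "y = (i', j')"
        by (cases x, cases y)
      then have ij: "i \<in> D" "i' \<in> D" "j \<in> {..<q - 1}" "j' \<in> {..<q - 1}"
        and eq: "g [^]\<^bsub>L\<^esub> (i + N * j) = g [^]\<^bsub>L\<^esub> (i' + N * j')"
        using xy by auto
      have "a + N * b < q ^ 3 - 1" if "a \<in> D" "b \<in> {..<q - 1}" for a b
      proof -
        have "a + N * b < N * Suc b" using that by (simp add: D_def)
        also have "\<dots> \<le> N * (q - 1)" using that by (intro mult_le_mono2) simp
        finally show ?thesis by (simp only: N)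
      qed
      then have "i + N * j = i' + N * j'"
        using ij eq g(4) by (auto simp: bij_betw_def dest!: inj_onD)
      then have "(i + N * j) mod N = (i' + N * j') mod N" "(i + N * j) div N = (i' + N * j') div N"
        by simp_all
      then show "x = y"
        using ij by (simp add: e D_def)
    qed
    then have "card D * (q - 1) = card (?h ` (D \<times> {..<q - 1}))"
      by (simp add: card_image card_cartesian_product)
    also have "\<dots> \<le> card (W - {\<zero>\<^bsub>L\<^esub>})"
    proof (intro card_mono image_subsetI, goal_cases)
      case 1
      show ?case using fin(1) WK finite_subset by blast
    next
      case (2 x)
      then have "g [^]\<^bsub>L\<^esub> (N * snd x) \<otimes>\<^bsub>L\<^esub> g [^]\<^bsub>L\<^esub> fst x \<in> W"
        by (intro Wmult[OF gF]) (auto simp: D_def)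
      then show ?case
        using g_nz by (auto simp: nat_pow_mult add.commute split: prod.split)
    qed
    also have "\<dots> = (q + 1) * (q - 1)"
      using W0 cW q by (simp add: power2_eq_square algebra_simps)
    finally show ?thesis .
  qed
  then have "card D \<le> q + 1"
    by (rule mult_right_le_imp_le) (use q in simp)
  moreover have "\<exists>i\<in>D. \<exists>j\<in>D. i = (j + d) mod N" for d
  proof -
    define c where "c = g [^]\<^bsub>L\<^esub> d"
    have c: "c \<in> K" "c \<in> carrier L" "c \<noteq> \<zero>\<^bsub>L\<^esub>"
    proof -
      show "c \<in> K"
        unfolding c_def using g(1) K(3,6) by (induction d) auto
    qed (simp_all add: c_def)
    let ?h = "\<lambda>(v, w). v \<oplus>\<^bsub>L\<^esub> c \<otimes>\<^bsub>L\<^esub> w"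
    \<comment> \<open>There are \<open>q\<^sup>4\<close> pairs and only \<open>q\<^sup>3\<close> values, so \<open>W\<close> and \<open>c W\<close> share a nonzero vector.\<close>
    have "?h ` (W \<times> W) \<subseteq> K"
      using subsetD[OF WK] c(1) by (auto intro!: K(6,7))
    then have "card (?h ` (W \<times> W)) \<le> q ^ 3"
      using cK fin card_mono by metis
    also have "\<dots> < card (W \<times> W)"
      using q by (simp add: card_cartesian_product cW power_add[symmetric])
    finally have "\<not> inj_on ?h (W \<times> W)"
      by (rule pigeonhole)
    then obtain v w v' w' where W4: "v \<in> W" "w \<in> W" "v' \<in> W" "w' \<in> W" and ne: "(v, w) \<noteq> (v', w')"
      and eq: "v \<oplus>\<^bsub>L\<^esub> c \<otimes>\<^bsub>L\<^esub> w = v' \<oplus>\<^bsub>L\<^esub> c \<otimes>\<^bsub>L\<^esub> w'"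
      by (auto simp: inj_on_def)
    have eq': "v \<ominus>\<^bsub>L\<^esub> v' = c \<otimes>\<^bsub>L\<^esub> (w' \<ominus>\<^bsub>L\<^esub> w)"
      using eq W4 c by (intro eq_add_mult_imp_diff) (simp_all add: WL)
    have "w' \<noteq> w"
    proof
      assume "w' = w"
      then have "v \<ominus>\<^bsub>L\<^esub> v' = \<zero>\<^bsub>L\<^esub>"
        using eq' c WL[OF W4(2)] by (simp add: a_minus_def r_neg)
      then show False
        using ne \<open>w' = w\<close> W4 by (simp add: WL)
    qed
    then have "w' \<ominus>\<^bsub>L\<^esub> w \<in> K - {\<zero>\<^bsub>L\<^esub>}"
      using W4 Wdiff WK r_right_minus_eq[of w' w] by (auto simp: WL)
    then obtain j where j: "w' \<ominus>\<^bsub>L\<^esub> w = g [^]\<^bsub>L\<^esub> (j::nat)"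
      using g(4) unfolding bij_betw_def by blast
    have "g [^]\<^bsub>L\<^esub> (j + d) = v \<ominus>\<^bsub>L\<^esub> v'"
      unfolding eq' j c_def by (simp add: nat_pow_mult add.commute)
    \<comment> \<open>Both \<open>g^j = w' - w\<close> and \<open>g^(j + d) = v - v'\<close> lie in
      \<open>W\<close>.\<close>
    then have "j mod N \<in> D" "(j + d) mod N \<in> D"
      using W4 Wdiff j by (auto intro!: memD simp flip: j)
    then show ?thesis
      by (metis mod_add_left_eq)
  qed
  ultimately show ?thesis
    by (intro that[of D]) (auto simp: D_def)
qed


text \<open>
  The \<open>N - 1\<close> nonzero residues are all differences of elements of \<open>D\<close>, and there are at most
  \<open>(q + 1) q = N - 1\<close> ordered pairs of distinct elements, so every difference occurs exactly once.
\<close>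

lemma singer_difference_set:
  fixes q :: nat
  assumes "primepow q"
  defines "N \<equiv> q\<^sup>2 + q + 1"
  obtains D where "D \<subseteq> {..<N}" "card D = q + 1"
    "\<And>d. \<exists>i\<in>D. \<exists>j\<in>D. i = (j + d) mod N"
    "\<And>i j i' j'. \<lbrakk>i \<in> D; j \<in> D; i' \<in> D; j' \<in> D; i \<noteq> j; [i + j' = i' + j] (mod N)\<rbrakk> \<Longrightarrow> i = i' \<and> j = j'"
proof -
  obtain p k where "prime p" "k > 0" "q = p ^ k"
    using assms(1) by (auto simp: primepow_def)
  then obtain D where D: "D \<subseteq> {..<N}" "card D \<le> q + 1" "\<And>d. \<exists>i\<in>D. \<exists>j\<in>D. i = (j + d) mod N"
    using singer_covering[of p k] unfolding N_def by metis
  have fin: "finite D"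
    using D(1) finite_subset by blast
  define A where "A = D \<times> D - Id_on D"
  \<comment> \<open>The difference \<open>i - j\<close> modulo \<open>N\<close>; the summand
    \<open>N - j\<close> stands for \<open>- j\<close> in the natural numbers.\<close>
  let ?f = "\<lambda>(i, j). (i + (N - j)) mod N"
  have finA: "finite A" and cA: "card A = card D * (card D - 1)"
  proof -
    have "card (Id_on D) = card D"
      by (simp add: Id_on_def card_UN_disjoint[where A = "\<lambda>x. {(x, x)}", simplified] fin)
    moreover have "Id_on D \<subseteq> D \<times> D" by auto
    ultimately show "card A = card D * (card D - 1)"
      using fin by (simp add: A_def card_Diff_subset finite_subset card_cartesian_product diff_mult_distrib2)
  qed (use fin in \<open>simp add: A_def\<close>)
  have "{1..<N} \<subseteq> ?f ` A"
  proof
    fix d assume d: "d \<in> {1..<N}"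
    obtain i j where ij: "i \<in> D" "j \<in> D" "i = (j + d) mod N"
      using D(3) by blast
    have "i < N" "j < N" using ij D(1) by auto
    have "(i + (N - j)) mod N = (j + d + (N - j)) mod N"
      unfolding ij(3) by (simp add: mod_simps)
    also have "j + d + (N - j) = d + N"
      using \<open>j < N\<close> by simp
    finally have "?f (i, j) = d" using d by simp
    moreover have "i \<noteq> j"
      using \<open>?f (i, j) = d\<close> d \<open>j < N\<close> by auto
    ultimately show "d \<in> ?f ` A"
      using ij(1,2) by (intro image_eqI[of _ _ "(i, j)"]) (auto simp: A_def)
  qed
  then have "card {1..<N} \<le> card (?f ` A)"
    using finA by (intro card_mono) auto
  then have *: "N - 1 \<le> card (?f ` A)" by simp
  have **: "card (?f ` A) \<le> card D * (card D - 1)"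
    using card_image_le[OF finA] cA by metis
  have "card D * (card D - 1) \<le> (q + 1) * q"
    using D(2) by (intro mult_le_mono) auto
  then have eq: "card D * (card D - 1) = (q + 1) * q" "card (?f ` A) = card A"
    using * ** cA by (simp_all add: N_def power2_eq_square)
  have cD: "card D = q + 1"
  proof (rule ccontr)
    assume "card D \<noteq> q + 1"
    then have "card D * (card D - 1) \<le> q * (card D - 1)" "card D - 1 \<le> q"
      using D(2) by (auto intro!: mult_le_mono1)
    then have "card D * (card D - 1) \<le> q * q"
      by (meson le_trans mult_le_mono2)
    with eq(1) show False
      using assms(1) primepow_gt_0_nat[of q] by simp
  qed
  have inj: "inj_on ?f A"
    using eq_card_imp_inj_on[OF finA eq(2)] .
  have "i = i' \<and> j = j'"
    if ij: "i \<in> D" "j \<in> D" "i' \<in> D" "j' \<in> D" "i \<noteq> j" "[i + j' = i' + j] (mod N)" for i j i' j'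
  proof -
    have lt: "i < N" "j < N" "i' < N" "j' < N" using ij D(1) by auto
    have "i' \<noteq> j'"
    proof
      assume "i' = j'"
      then have "[i = j] (mod N)"
        using ij(6) by (metis add.commute cong_add_lcancel_nat)
      with lt ij(5) show False by (simp add: cong_def)
    qed
    \<comment> \<open>Adding the negatives of \<open>j\<close> and \<open>j'\<close> turns the
      equation between sums into one between the differences \<open>i - j\<close> and
      \<open>i' - j'\<close>.\<close>
    have "[i + j' + (N - j) + (N - j') = i' + j + (N - j) + (N - j')] (mod N)"
      by (intro cong_add[OF cong_add[OF ij(6) cong_refl] cong_refl])
    moreover have "i + j' + (N - j) + (N - j') = i + (N - j) + N" "i' + j + (N - j) + (N - j') = i' + (N - j') + N"
      using lt by simp_all
    ultimately have "[i + (N - j) + N = i' + (N - j') + N] (mod N)"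
      by (simp only:)
    then have "?f (i, j) = ?f (i', j')"
      by (simp only: cong_add_rcancel_nat) (simp only: cong_def prod.case)
    then have "(i, j) = (i', j')"
      using ij \<open>i' \<noteq> j'\<close> by (intro inj_onD[OF inj]) (auto simp: A_def)
    then show ?thesis by simp
  qed
  then show ?thesis
    by (rule that[OF D(1) cD D(3)])
qed

text \<open>
  A projective plane of order \<open>n\<close> with points and lines numbered by the residues modulo \<open>N\<close> such
  that \<open>0, line 0, 1, line 1, \<dots>\<close> is a Hamiltonian cycle of its incidence graph.
\<close>

locale cyclic_plane =
  fixes n N :: nat and on :: "nat \<Rightarrow> nat \<Rightarrow> bool"
  assumes order: "n > 0" "N = n\<^sup>2 + n + 1"
    and on_bounds: "on x l \<Longrightarrow> x < N" "on x l \<Longrightarrow> l < N"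
    and line_exists: "\<lbrakk>x < N; y < N; x \<noteq> y\<rbrakk> \<Longrightarrow> \<exists>l. on x l \<and> on y l"
    and point_exists: "\<lbrakk>l < N; m < N; l \<noteq> m\<rbrakk> \<Longrightarrow> \<exists>x. on x l \<and> on x m"
    and two_points: "\<lbrakk>on x l; on y l; on x m; on y m; x \<noteq> y\<rbrakk> \<Longrightarrow> l = m"
    and card_line: "l < N \<Longrightarrow> card {x. on x l} = n + 1"
    and card_pencil: "x < N \<Longrightarrow> card {l. on x l} = n + 1"
    and on_self: "i < N \<Longrightarrow> on i i"
    and on_next: "i < N \<Longrightarrow> on (Suc i mod N) i"

text \<open>The lines are the translates of the difference set. That every difference occurs yields
  a common line of two points and, dually, a common point of two lines; that nonzero differences
  occur only once makes the common line unique.\<close>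

lemma cyclic_plane_exists:
  assumes "primepow q"
  obtains on where "cyclic_plane q (q\<^sup>2 + q + 1) on"
proof -
  define N where "N = q\<^sup>2 + q + 1"
  obtain D where D: "D \<subseteq> {..<N}" "card D = q + 1"
    and cov: "\<And>d. \<exists>i\<in>D. \<exists>j\<in>D. i = (j + d) mod N"
    and uniq: "\<And>i j i' j'. \<lbrakk>i \<in> D; j \<in> D; i' \<in> D; j' \<in> D; i \<noteq> j; [i + j' = i' + j] (mod N)\<rbrakk> \<Longrightarrow> i = i' \<and> j = j'"
    using singer_difference_set[OF assms] unfolding N_def by blast
  have q: "q > 0" using assms by (rule primepow_gt_0_nat)
  then have N: "N > 1" by (simp add: N_def)
  \<comment> \<open>Two elements of \<open>D\<close> with difference 1. Shifting the incidence by
    \<open>c\<close> lets \<open>c\<close> put point \<open>i\<close> on line \<open>i\<close>, and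
    \<open>c1\<close> put point \<open>i + 1\<close> on line \<open>i\<close>.\<close>
  obtain c1 c where c: "c1 \<in> D" "c \<in> D" "c1 = (c + 1) mod N"
    using cov[of 1] by blast
  define on where "on x l \<longleftrightarrow> x < N \<and> l < N \<and> (\<exists>d\<in>D. [x + c = l + d] (mod N))" for x l
  have line: "{x. on x l} = (\<lambda>d. (l + d + (N - c)) mod N) ` D" if "l < N" for l
  proof -
    have "[x + c = l + d] (mod N) \<longleftrightarrow> x = (l + d + (N - c)) mod N" if "x < N" for x d
    proof -
      have "[x + c = l + d] (mod N) \<longleftrightarrow> [x + c + (N - c) = l + d + (N - c)] (mod N)"
        by (simp only: cong_add_rcancel_nat)
      also have "x + c + (N - c) = x + N" using c D by auto
      finally show ?thesis using \<open>x < N\<close> by (auto simp: cong_def)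
    qed
    then show ?thesis
      using \<open>l < N\<close> N by (auto simp: on_def)
  qed
  have pencil: "{l. on x l} = (\<lambda>d. (x + c + (N - d)) mod N) ` D" if "x < N" for x
  proof -
    have "[x + c = l + d] (mod N) \<longleftrightarrow> l = (x + c + (N - d)) mod N" if "l < N" "d \<in> D" for l d
    proof -
      have "[x + c = l + d] (mod N) \<longleftrightarrow> [x + c + (N - d) = l + d + (N - d)] (mod N)"
        by (simp only: cong_add_rcancel_nat)
      also have "l + d + (N - d) = l + N" using that D by auto
      finally show ?thesis using \<open>l < N\<close> by (auto simp: cong_def)
    qed
    then show ?thesis
      using \<open>x < N\<close> N by (auto simp: on_def)
  qed
  have "cyclic_plane q N on"
  proof
    show "q > 0" "N = q\<^sup>2 + q + 1" by (simp_all add: q N_def)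
    show "on x l \<Longrightarrow> x < N" "on x l \<Longrightarrow> l < N" for x l by (auto simp: on_def)
  next
    fix x y assume xy: "x < N" "y < N" "x \<noteq> y"
    \<comment> \<open>With \<open>i - j = x - y\<close>, the line \<open>x + c - i\<close> equals
      \<open>y + c - j\<close> and so contains both points.\<close>
    obtain i j where ij: "i \<in> D" "j \<in> D" "i = (j + (x + (N - y))) mod N"
      using cov by blast
    have "[i = j + (x + (N - y))] (mod N)" using ij(3) by (simp add: cong_def)
    then have "[i + y = j + (x + (N - y)) + y] (mod N)" by (rule cong_add[OF _ cong_refl])
    also have "j + (x + (N - y)) + y = j + x + N" using xy by simp
    finally have e: "[i + y = j + x] (mod N)" by (simp add: cong_def)
    define l where "l = (x + c + (N - i)) mod N"
    have "l \<in> {l. on x l}" unfolding pencil[OF xy(1)] l_def using ij(1) by blast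
    moreover have "on y l"
    proof -
      have "[l + j = x + c + (N - i) + j] (mod N)" by (simp add: l_def cong_def mod_simps)
      also have "x + c + (N - i) + j = (j + x) + (c + (N - i))" by simp
      also have "[\<dots> = (i + y) + (c + (N - i))] (mod N)"
        by (rule cong_add[OF cong_sym[OF e] cong_refl])
      also have "(i + y) + (c + (N - i)) = y + c + N" using ij D by auto
      finally have "[y + c = l + j] (mod N)" by (simp add: cong_def)
      then show ?thesis using ij xy N by (auto simp: on_def l_def)
    qed
    ultimately show "\<exists>l. on x l \<and> on y l" by auto
  next
    fix l m assume lm: "l < N" "m < N" "l \<noteq> m"
    \<comment> \<open>With \<open>i - j = m - l\<close>, the point \<open>l + i - c\<close> equals
      \<open>m + j - c\<close> and so lies on both lines.\<close>
    obtain i j where ij: "i \<in> D" "j \<in> D" "i = (j + (m + (N - l))) mod N"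
      using cov by blast
    have "[i = j + (m + (N - l))] (mod N)" using ij(3) by (simp add: cong_def)
    then have "[i + l = j + (m + (N - l)) + l] (mod N)" by (rule cong_add[OF _ cong_refl])
    also have "j + (m + (N - l)) + l = m + j + N" using lm by simp
    finally have e: "[l + i = m + j] (mod N)" by (simp add: cong_def add.commute)
    define x where "x = (l + i + (N - c)) mod N"
    have "[x + c = l + i + (N - c) + c] (mod N)" by (simp add: x_def cong_def mod_simps)
    also have "l + i + (N - c) + c = l + i + N" using c D by auto
    finally have x: "[x + c = l + i] (mod N)" by (simp add: cong_def)
    then have "on x l" "on x m"
      using ij lm N cong_trans[OF x e] by (auto simp: on_def x_def)
    then show "\<exists>x. on x l \<and> on x m" by auto
  next
    fix x y l m assume on: "on x l" "on y l" "on x m" "on y m" and ne: "x \<noteq> y"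
    have lt: "x < N" "y < N" "l < N" "m < N" using on by (auto simp: on_def)
    obtain i j i' j' where ij: "i \<in> D" "j \<in> D" "i' \<in> D" "j' \<in> D"
      and e: "[x + c = l + i] (mod N)" "[y + c = l + j] (mod N)"
        "[x + c = m + i'] (mod N)" "[y + c = m + j'] (mod N)"
      using on by (auto simp: on_def)
    have "i \<noteq> j"
    proof
      assume "i = j"
      then have "[x + c = y + c] (mod N)"
        using e(1,2) by (metis cong_trans cong_sym)
      then have "[x = y] (mod N)"
        by (simp only: cong_add_rcancel_nat)
      then show False
        using ne lt by (simp add: cong_def)
    qed
    \<comment> \<open>Both \<open>i - j\<close> and \<open>i' - j'\<close> equal
      \<open>x - y\<close>; the crosswise sums express this without subtraction.\<close>
    have "[(x + c) + (y + c) = (l + i) + (m + j')] (mod N)" "[(x + c) + (y + c) = (m + i') + (l + j)] (mod N)"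
      using cong_add[OF e(1) e(4)] cong_add[OF e(3) e(2)] by simp_all
    then have "[(l + i) + (m + j') = (m + i') + (l + j)] (mod N)"
      using cong_trans cong_sym by blast
    then have "[(l + m) + (i + j') = (l + m) + (i' + j)] (mod N)"
      by (simp add: ac_simps)
    then have "[i + j' = i' + j] (mod N)"
      by (simp only: cong_add_lcancel_nat)
    then have "i = i'"
      using uniq ij \<open>i \<noteq> j\<close> by blast
    then have "[l + i = m + i] (mod N)"
      using e(1,3) cong_trans cong_sym by blast
    then have "[l = m] (mod N)"
      by (simp only: cong_add_rcancel_nat)
    then show "l = m"
      using lt by (simp add: cong_def)
  next
    fix l assume l: "l < N"
    have "inj_on (\<lambda>d. (l + d + (N - c)) mod N) D"
    proof (rule inj_onI)
      fix d e assume de: "d \<in> D" "e \<in> D" "(l + d + (N - c)) mod N = (l + e + (N - c)) mod N"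
      then have "[d + (l + (N - c)) = e + (l + (N - c))] (mod N)" by (simp add: cong_def ac_simps)
      then have "[d = e] (mod N)" by (simp only: cong_add_rcancel_nat)
      then show "d = e" using de(1,2) D(1) by (auto simp: cong_def subset_iff)
    qed
    then show "card {x. on x l} = q + 1"
      unfolding line[OF l] using D(2) by (simp add: card_image)
  next
    fix x assume x: "x < N"
    have "inj_on (\<lambda>d. (x + c + (N - d)) mod N) D"
    proof (rule inj_onI)
      fix d e assume de: "d \<in> D" "e \<in> D" "(x + c + (N - d)) mod N = (x + c + (N - e)) mod N"
      then have "[(N - d) + (x + c) = (N - e) + (x + c)] (mod N)" by (simp add: cong_def ac_simps)
      then have "[N - d = N - e] (mod N)" by (simp only: cong_add_rcancel_nat)
      then have "[(N - d) + (d + e) = (N - e) + (d + e)] (mod N)" by (rule cong_add[OF _ cong_refl])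
      moreover have "(N - d) + (d + e) = N + e" "(N - e) + (d + e) = N + d" using de D by auto
      ultimately have "[N + e = N + d] (mod N)" by simp
      then show "d = e" using de(1,2) D(1) by (auto simp: cong_def subset_iff)
    qed
    then show "card {l. on x l} = q + 1"
      unfolding pencil[OF x] using D(2) by (simp add: card_image)
  next
    fix i assume i: "i < N"
    show "on i i" using i c(2) by (auto simp: on_def intro!: bexI[of _ c])
    have "[Suc i mod N + c = i + c1] (mod N)"
      unfolding c(3) by (simp add: cong_def mod_simps)
    then show "on (Suc i mod N) i" using i c N by (auto simp: on_def)
  qed
  then show ?thesis
    using that unfolding N_def by blast
qed

section \<open>Graphs with a uniquely descending distance function\<close>

text \<open>The conditions on \<open>\<delta>\<close> are local, so they can be checked arc by arc:
  an arc lowers \<open>\<delta>\<close> by at most one, and exactly one arc lowers it. They force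
  \<open>\<delta>\<close> to be the graph distance and geodesics to be unique.\<close>

locale descending_distance = pair_graph G for G :: "'a pair_pre_digraph" +
  fixes \<delta> :: "'a \<Rightarrow> 'a \<Rightarrow> nat"
  assumes dist_self: "v \<in> pverts G \<Longrightarrow> \<delta> v v = 0"
    and dist_arc: "\<lbrakk>(u, w) \<in> parcs G; v \<in> pverts G\<rbrakk> \<Longrightarrow> \<delta> u v \<le> Suc (\<delta> w v)"
    and dist_step: "\<lbrakk>u \<in> pverts G; v \<in> pverts G; u \<noteq> v\<rbrakk>
      \<Longrightarrow> \<exists>!w. (u, w) \<in> parcs G \<and> \<delta> u v = Suc (\<delta> w v)"
begin

lemma dist_le_length: "awalk u p v \<Longrightarrow> \<delta> u v \<le> length p"
proof (induction p arbitrary: u)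
  case Nil
  then show ?case by (auto simp: awalk_Nil_iff dist_self)
next
  case (Cons e p)
  then have "(u, snd e) \<in> parcs G" "awalk (snd e) p v"
    by (auto simp: awalk_Cons_iff)
  moreover from this have "v \<in> pverts G"
    by (blast intro: awalk_last_in_verts)
  ultimately show ?case
    using Cons.IH[of "snd e"] dist_arc[of u "snd e" v] by simp
qed

text \<open>From any vertex of the walk a final piece of it leads to \<open>v\<close>. This excludes
  repeated vertices in walks of length \<open>\<delta> u v\<close>.\<close>

lemma awalk_verts_dist_le: "\<lbrakk>awalk u p v; x \<in> set (pawalk_verts u p)\<rbrakk> \<Longrightarrow> \<delta> x v \<le> length p"
proof (induction p arbitrary: u)
  case Nil
  then show ?case using dist_le_length[of u "[]" v] by simp
next
  case (Cons e p)
  show ?case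
  proof (cases "x = u")
    case True
    then show ?thesis using dist_le_length[OF Cons.prems(1)] by simp
  next
    case False
    then show ?thesis using Cons.prems Cons.IH[of "snd e"] by (auto simp: awalk_Cons_iff)
  qed
qed

text \<open>The tail is at least as long as \<open>\<delta>\<close> from its start, and one arc
  lowers \<open>\<delta>\<close> by at most one; the length assumption makes both bounds
  tight.\<close>

lemma shortest_walk_tl:
  assumes "awalk u (e # p) v" "length (e # p) = \<delta> u v"
  shows "awalk (snd e) p v" "length p = \<delta> (snd e) v" "\<delta> u v = Suc (\<delta> (snd e) v)" "u \<noteq> v"
    "(u, snd e) \<in> parcs G"
proof -
  show w: "awalk (snd e) p v" and a: "(u, snd e) \<in> parcs G"
    using assms by (auto simp: awalk_Cons_iff)
  then have v: "v \<in> pverts G" by (blast intro: awalk_last_in_verts)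
  show "length p = \<delta> (snd e) v" "\<delta> u v = Suc (\<delta> (snd e) v)"
    using dist_le_length[OF w] dist_arc[OF a v] assms(2) by auto
  show "u \<noteq> v"
    using assms(2) dist_self[OF v] by auto
qed

text \<open>The start has larger \<open>\<delta>\<close> to \<open>v\<close> than any vertex of the
  tail can have, so it does not recur.\<close>

lemma shortest_walk_apath: "\<lbrakk>awalk u p v; length p = \<delta> u v\<rbrakk> \<Longrightarrow> apath u p v"
proof (induction p arbitrary: u)
  case Nil
  then show ?case by (auto simp: awalk_Nil_iff apath_Nil_iff)
next
  case (Cons e p)
  note tl = shortest_walk_tl[OF Cons.prems]
  have "u \<notin> set (pawalk_verts (snd e) p)"
    using awalk_verts_dist_le[OF tl(1), of u] tl(2,3) by auto
  then show ?case
    using Cons.prems Cons.IH[OF tl(1,2)] by (auto simp: apath_Cons_iff awalk_Cons_iff)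
qed

text \<open>Induction on \<open>\<delta>\<close>: the first arc must lower \<open>\<delta>\<close>,
  hence is forced by \<open>dist_step\<close>.\<close>

lemma ex1_shortest_walk:
  "\<lbrakk>u \<in> pverts G; v \<in> pverts G\<rbrakk> \<Longrightarrow> \<exists>!p. awalk u p v \<and> length p = \<delta> u v"
proof (induction "\<delta> u v" arbitrary: u)
  case 0
  then have "u = v" using dist_step[of u v] by fastforce
  then show ?case using 0 by (auto simp: awalk_Nil_iff)
next
  case (Suc n)
  then have "u \<noteq> v" using dist_self by force
  then obtain w where w: "(u, w) \<in> parcs G" "\<delta> u v = Suc (\<delta> w v)"
    and uniq: "\<And>x. \<lbrakk>(u, x) \<in> parcs G; \<delta> u v = Suc (\<delta> x v)\<rbrakk> \<Longrightarrow> x = w"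
    using dist_step[OF Suc.prems] by blast
  have "w \<in> pverts G" using w(1) by (rule in_arcsD2)
  with Suc w obtain p where p: "awalk w p v" "length p = \<delta> w v"
    and puniq: "\<And>p'. \<lbrakk>awalk w p' v; length p' = \<delta> w v\<rbrakk> \<Longrightarrow> p' = p"
    by (metis Suc_inject)
  show ?case
  proof (rule ex1I[of _ "(u, w) # p"])
    show "awalk u ((u, w) # p) v \<and> length ((u, w) # p) = \<delta> u v"
      using p w by (simp add: awalk_Cons_iff)
  next
    fix r assume r: "awalk u r v \<and> length r = \<delta> u v"
    then obtain e r' where e: "r = e # r'"
      using w(2) by (cases r) auto
    note tl = shortest_walk_tl[of u e r' v]
    have "snd e = w" using r e tl uniq by blast
    moreover have "r' = p" using r e tl puniq \<open>snd e = w\<close> by blast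
    moreover have "fst e = u" using r e by (simp add: awalk_Cons_iff)
    ultimately show "r = (u, w) # p" using e by (cases e) simp
  qed
qed

text \<open>Geodesics minimise over paths only, while \<open>\<delta>\<close> bounds all walks; the
  two agree because walks of length \<open>\<delta> u v\<close> are paths.\<close>

lemma geodesic_iff:
  assumes "u \<in> pverts G" "v \<in> pverts G"
  shows "geodesic (with_proj G) u p v \<longleftrightarrow> awalk u p v \<and> length p = \<delta> u v"
proof
  assume g: "geodesic (with_proj G) u p v"
  obtain r where "awalk u r v" "length r = \<delta> u v"
    using ex1_shortest_walk[OF assms] by blast
  then have "length p \<le> \<delta> u v"
    using g shortest_walk_apath by (fastforce simp: geodesic_def)
  then show "awalk u p v \<and> length p = \<delta> u v"
    using g dist_le_length[of u p v] by (auto simp: geodesic_def apath_def)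
next
  assume "awalk u p v \<and> length p = \<delta> u v"
  then show "geodesic (with_proj G) u p v"
    using shortest_walk_apath dist_le_length by (auto simp: geodesic_def apath_def)
qed

lemma geodetic: "geodetic_graph (with_proj G)"
  unfolding geodetic_graph_def using ex1_shortest_walk by (simp add: geodesic_iff)

lemma \<mu>_unit_eq_dist:
  assumes "u \<in> pverts G" "v \<in> pverts G"
  shows "\<mu> (\<lambda>_. 1) u v = ereal (\<delta> u v)"
proof -
  have cost: "awalk_cost (\<lambda>_. 1) p = length p" for p
    by (induction p) auto
  obtain r where "awalk u r v" "length r = \<delta> u v"
    using ex1_shortest_walk[OF assms] by blast
  then show ?thesis
    unfolding \<mu>_def cost using dist_le_length
    by (intro antisym INF_greatest INF_lower2[of r]) auto
qed

lemma graph_diameter_eq: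
  assumes "\<And>u v. \<lbrakk>u \<in> pverts G; v \<in> pverts G\<rbrakk> \<Longrightarrow> \<delta> u v \<le> k"
    and "a \<in> pverts G" "b \<in> pverts G" "\<delta> a b = k"
  shows "graph_diameter (with_proj G) = ereal k"
proof -
  have "(SUP u\<in>pverts G. SUP v\<in>pverts G. \<mu> (\<lambda>_. 1) u v) = ereal k"
  proof (rule antisym)
    show "(SUP u\<in>pverts G. SUP v\<in>pverts G. \<mu> (\<lambda>_. 1) u v) \<le> ereal k"
      using assms(1) by (intro SUP_least) (simp add: \<mu>_unit_eq_dist)
    have "ereal k = \<mu> (\<lambda>_. 1) a b"
      using assms by (simp add: \<mu>_unit_eq_dist)
    also have "\<dots> \<le> (SUP u\<in>pverts G. SUP v\<in>pverts G. \<mu> (\<lambda>_. 1) u v)"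
      by (rule SUP_upper2[OF assms(2) SUP_upper[OF assms(3)]])
    finally show "ereal k \<le> (SUP u\<in>pverts G. SUP v\<in>pverts G. \<mu> (\<lambda>_. 1) u v)" .
  qed
  then show ?thesis
    by (simp add: graph_diameter_def)
qed

end

section \<open>Hamiltonian cycles from cyclic vertex lists\<close>

lemma (in pair_wf_digraph) awalk_vwalk_arcs:
  assumes "xs \<noteq> []" "hd xs \<in> pverts G" "successively (\<lambda>x y. (x, y) \<in> parcs G) xs"
  shows "awalk (hd xs) (vwalk_arcs xs) (last xs)" "pawalk_verts (hd xs) (vwalk_arcs xs) = xs"
  using assms
  by (induction xs rule: vwalk_arcs.induct) (auto simp: awalk_simps in_arcsD2)

lemma (in pair_wf_digraph) hamiltonian_if_cyclic_list:
  assumes "distinct xs" "set xs = pverts G" "3 \<le> length xs"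
    and "successively (\<lambda>x y. (x, y) \<in> parcs G) xs" "(last xs, hd xs) \<in> parcs G"
  shows "hamiltonian_graph (with_proj G)"
proof -
  have ne: "xs \<noteq> []" using assms(3) by auto
  let ?u = "hd xs" and ?p = "vwalk_arcs (xs @ [hd xs])"
  have u: "?u \<in> pverts G" using ne assms(2) hd_in_set by blast
  have w: "awalk ?u ?p ?u" "pawalk_verts ?u ?p = xs @ [?u]"
    using awalk_vwalk_arcs[of "xs @ [?u]"] ne u assms(4,5) by (auto simp: successively_append_iff)
  \<comment> \<open>Dropping the first vertex leaves its second occurrence at the end as the only
    one.\<close>
  have "distinct (tl (pawalk_verts ?u ?p))"
    using assms(1) ne unfolding w(2) by (cases xs) auto
  moreover have len: "length ?p = length xs"
    by (simp flip: vwalk_length_def)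
  moreover from len have "?p \<noteq> []" using assms(3) by auto
  ultimately have "cycle ?p"
    unfolding cycle_def using w(1) by blast
  moreover have "set (pawalk_verts ?u ?p) = pverts G"
    unfolding w(2) using assms(2) u by auto
  ultimately show ?thesis
    unfolding hamiltonian_graph_def using w(1) len assms(3)
    by (intro exI[of _ ?u] exI[of _ ?p]) simp
qed

section \<open>The flag graph of a cyclic plane\<close>

text \<open>Vertices are coded pairs: second component 0 marks a point and \<open>Suc l\<close> a
  flag on line \<open>l\<close>, so both kinds live in one type without collisions.\<close>

definition pt :: "nat \<Rightarrow> nat" where
  "pt x = prod_encode (x, 0)"

definition fl :: "nat \<Rightarrow> nat \<Rightarrow> nat" where
  "fl x l = prod_encode (x, Suc l)"

lemma pt_fl_simps [simp]:
  "pt x = pt y \<longleftrightarrow> x = y" "fl x l = fl y m \<longleftrightarrow> x = y \<and> l = m" "pt x \<noteq> fl y m" "fl y m \<noteq> pt x"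
  by (auto simp: pt_def fl_def)

context cyclic_plane
begin

definition flag_graph :: "nat pair_pre_digraph" where
  "flag_graph = \<lparr>pverts = pt ` {..<N} \<union> {fl x l | x l. on x l},
     parcs = {(pt x, fl x l) | x l. on x l} \<union> {(fl x l, pt x) | x l. on x l} \<union>
       {(fl x l, fl y l) | x y l. on x l \<and> on y l \<and> x \<noteq> y}\<rparr>"

text \<open>Two points are joined through both their flags on the common line, hence 3. Flags on
  distinct lines are joined through the common point of these lines: 4 steps, less one for each of
  the two flags that already sits at that point.\<close>

fun code_dist :: "nat \<times> nat \<Rightarrow> nat \<times> nat \<Rightarrow> nat" where
  "code_dist (p, 0) (q, 0) = (if p = q then 0 else 3)"
| "code_dist (p, Suc L) (q, 0) = (if p = q then 1 else if on q L then 2 else 4)"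
| "code_dist (p, 0) (q, Suc M) = (if p = q then 1 else if on p M then 2 else 4)"
| "code_dist (p, Suc L) (q, Suc M) =
    (if L = M then if p = q then 0 else 1
     else if p = q then 2 else if on p M \<or> on q L then 3 else 4)"

definition flag_dist :: "nat \<Rightarrow> nat \<Rightarrow> nat" where
  "flag_dist u v = code_dist (prod_decode u) (prod_decode v)"

lemma flag_dist_le_4: "flag_dist u v \<le> 4"
proof -
  have "code_dist a b \<le> 4" for a b
    by (induction a b rule: code_dist.induct) auto
  then show ?thesis by (simp add: flag_dist_def)
qed

lemma flag_dist_simps [simp]:
  "flag_dist (pt p) (pt q) = (if p = q then 0 else 3)"
  "flag_dist (fl p L) (pt q) = (if p = q then 1 else if on q L then 2 else 4)"
  "flag_dist (pt p) (fl q M) = (if p = q then 1 else if on p M then 2 else 4)"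
  "flag_dist (fl p L) (fl q M) =
    (if L = M then if p = q then 0 else 1
     else if p = q then 2 else if on p M \<or> on q L then 3 else 4)"
  by (simp_all add: flag_dist_def pt_def fl_def)

lemma verts_cases:
  assumes "v \<in> pverts flag_graph"
  obtains (pt) x where "v = pt x" "x < N" | (fl) x l where "v = fl x l" "on x l"
  using assms by (auto simp: flag_graph_def)

lemma in_verts [simp]:
  "pt x \<in> pverts flag_graph \<longleftrightarrow> x < N" "fl x l \<in> pverts flag_graph \<longleftrightarrow> on x l"
  by (auto simp: flag_graph_def)

lemma arcs_iff:
  "(pt x, w) \<in> parcs flag_graph \<longleftrightarrow> (\<exists>l. on x l \<and> w = fl x l)"
  "(fl x l, w) \<in> parcs flag_graph \<longleftrightarrow> on x l \<and> (w = pt x \<or> (\<exists>y. on y l \<and> y \<noteq> x \<and> w = fl y l))"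
  by (auto simp: flag_graph_def)

lemma pair_graph_flag_graph: "pair_graph flag_graph"
proof
  have "{fl x l | x l. on x l} \<subseteq> (\<lambda>(x, l). fl x l) ` ({..<N} \<times> {..<N})"
    using on_bounds by fastforce
  then have "finite {fl x l | x l. on x l}"
    by (rule finite_subset) simp
  then show fin: "finite (pverts flag_graph)"
    by (simp add: flag_graph_def)
  show "e \<in> parcs flag_graph \<Longrightarrow> fst e \<in> pverts flag_graph"
    and snd: "e \<in> parcs flag_graph \<Longrightarrow> snd e \<in> pverts flag_graph" for e
    using on_bounds by (auto simp: flag_graph_def)
  then have "parcs flag_graph \<subseteq> pverts flag_graph \<times> pverts flag_graph"
    by (auto simp: mem_Times_iff)
  then show "finite (parcs flag_graph)"
    by (rule finite_subset) (simp add: fin)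
  show "e \<in> parcs flag_graph \<Longrightarrow> fst e \<noteq> snd e" for e
    by (auto simp: flag_graph_def)
  show "symmetric (with_proj flag_graph)"
    by (auto simp: flag_graph_def symmetric_def sym_def)
qed

lemma flag_dist_arc:
  assumes "(u, w) \<in> parcs flag_graph" "v \<in> pverts flag_graph"
  shows "flag_dist u v \<le> Suc (flag_dist w v)"
proof -
  have u: "u \<in> pverts flag_graph"
    using assms(1) on_bounds by (auto simp: flag_graph_def)
  show ?thesis
    using u
  proof (cases rule: verts_cases)
    case (pt x)
    with assms(1) obtain l where l: "on x l" "w = fl x l" by (auto simp: arcs_iff)
    with assms(2) pt show ?thesis
      by (elim verts_cases) auto
  next
    case (fl x l)
    with assms(1) consider "w = pt x" | y where "w = fl y l" "on y l" "y \<noteq> x"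
      by (auto simp: arcs_iff)
    then show ?thesis
      using assms(2) fl by cases (auto elim!: verts_cases)
  qed
qed

text \<open>The next vertex on the way to the target is given by the line joining two points or by
  the point common to two lines, and it is unique because these are.\<close>

lemma flag_dist_step:
  assumes u: "u \<in> pverts flag_graph" and v: "v \<in> pverts flag_graph" and ne: "u \<noteq> v"
  shows "\<exists>!w. (u, w) \<in> parcs flag_graph \<and> flag_dist u v = Suc (flag_dist w v)"
  using u
proof (cases rule: verts_cases)
  case p: (pt p)
  from v show ?thesis
  proof (cases rule: verts_cases)
    case q: (pt q)
    then have "p \<noteq> q" using ne p by auto
    then obtain l where l: "on p l" "on q l" using line_exists p q by blast
    show ?thesis
      using l \<open>p \<noteq> q\<close> unfolding p(1) q(1)
      by (intro ex1I[of _ "fl p l"])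
        (auto simp: arcs_iff split: if_splits intro: two_points[OF _ _ l \<open>p \<noteq> q\<close>])
  next
    case q: (fl q m)
    then have q': "q < N" "m < N" using on_bounds by auto
    consider "p = q" | "p \<noteq> q" "on p m" | "p \<noteq> q" "\<not> on p m" by blast
    then show ?thesis
    proof cases
      case 1
      then show ?thesis
        using q(2) unfolding p(1) q(1)
        by (intro ex1I[of _ "fl q m"]) (auto simp: arcs_iff split: if_splits)
    next
      case 2
      then show ?thesis
        using q(2) unfolding p(1) q(1)
        by (intro ex1I[of _ "fl p m"]) (auto simp: arcs_iff split: if_splits)
    next
      case 3
      then obtain l where l: "on p l" "on q l" using line_exists p q' by blast
      show ?thesis
        using 3 l q(2) unfolding p(1) q(1)
        by (intro ex1I[of _ "fl p l"])
          (auto simp: arcs_iff split: if_splits intro: two_points[OF _ _ l \<open>p \<noteq> q\<close>])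
    qed
  qed
next
  case p: (fl p l)
  then have p': "p < N" "l < N" using on_bounds by auto
  from v show ?thesis
  proof (cases rule: verts_cases)
    case q: (pt q)
    consider "p = q" | "p \<noteq> q" "on q l" | "p \<noteq> q" "\<not> on q l" by blast
    then show ?thesis
    proof cases
      case 1
      then show ?thesis
        using p(2) unfolding p(1) q(1)
        by (intro ex1I[of _ "pt q"]) (auto simp: arcs_iff split: if_splits)
    next
      case 2
      then show ?thesis
        using p(2) unfolding p(1) q(1)
        by (intro ex1I[of _ "fl q l"]) (auto simp: arcs_iff split: if_splits)
    next
      \<comment> \<open>The line joining \<open>p\<close> and \<open>q\<close> differs from
        \<open>l\<close>, so the way leaves \<open>l\<close> at once through
        \<open>p\<close>.\<close>
      case 3
      then show ?thesis
        using p(2) unfolding p(1) q(1)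
        by (intro ex1I[of _ "pt p"]) (auto simp: arcs_iff split: if_splits)
    qed
  next
    case q: (fl q m)
    then have q': "q < N" "m < N" using on_bounds by auto
    consider "l = m" "p \<noteq> q" | "l \<noteq> m" "p = q" | "l \<noteq> m" "p \<noteq> q" "on p m" | "l \<noteq> m" "p \<noteq> q" "on q l"
      | "l \<noteq> m" "\<not> on p m" "\<not> on q l" using ne p q by auto
    then show ?thesis
    proof cases
      case 1
      then show ?thesis
        using p(2) q(2) unfolding p(1) q(1)
        by (intro ex1I[of _ "fl q m"]) (auto simp: arcs_iff split: if_splits)
    next
      case 2
      then show ?thesis
        using p(2) q(2) unfolding p(1) q(1)
        by (intro ex1I[of _ "pt p"]) (auto simp: arcs_iff split: if_splits)
    next
      case 3
      \<comment> \<open>Otherwise \<open>l\<close> and \<open>m\<close> would share the two points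
        \<open>p\<close> and \<open>q\<close>.\<close>
      then have "\<not> on q l"
        using two_points[OF p(2) _ _ q(2)] by auto
      with 3 show ?thesis
        using p(2) q(2) unfolding p(1) q(1)
        by (intro ex1I[of _ "pt p"]) (auto simp: arcs_iff split: if_splits)
    next
      case 4
      then have "\<not> on p m"
        using two_points[OF p(2) _ _ q(2)] by auto
      with 4 show ?thesis
        using p(2) q(2) unfolding p(1) q(1)
        by (intro ex1I[of _ "fl q l"]) (auto simp: arcs_iff split: if_splits)
    next
      case 5
      then obtain r where r: "on r l" "on r m" using point_exists p' q' by blast
      have uniq: "s = r" if "on s l" "on s m" for s
        using two_points[OF that(1) r(1) that(2) r(2)] 5(1) by auto
      show ?thesis
        using 5 r p(2) q(2) unfolding p(1) q(1)
        by (intro ex1I[of _ "fl r l"]) (auto simp: arcs_iff split: if_splits intro: uniq)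
    qed
  qed
qed

lemma descending_distance_flag_graph: "descending_distance flag_graph flag_dist"
proof (intro descending_distance.intro pair_graph_flag_graph, unfold_locales)
  show "v \<in> pverts flag_graph \<Longrightarrow> flag_dist v v = 0" for v
    by (auto elim: verts_cases)
qed (rule flag_dist_arc flag_dist_step; assumption)+

lemma order_bounds: "N \<ge> 3" "n + 1 < N"
  by (use order in \<open>cases n; auto simp: power2_eq_square\<close>)+

section \<open>Diameter, degrees and number of vertices\<close>

lemma finite_line: "finite {x. on x l}"
  by (rule finite_subset[of _ "{..<N}"]) (auto dest: on_bounds(1))

lemma flag_graph_diameter: "graph_diameter (with_proj flag_graph) = 4"
proof -
  obtain x where x: "x < N" "\<not> on x 0"
  proof -
    have "card {x. on x 0} < card {..<N}"
      using card_line[of 0] order_bounds by simp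
    then have "\<not> {..<N} \<subseteq> {x. on x 0}"
      using card_mono[OF finite_line] by (meson not_less)
    then show ?thesis using that by (auto simp: subset_iff)
  qed
  have 0: "on 0 0" using on_self order_bounds by simp
  then have "x \<noteq> 0" using x(2) by metis
  have "graph_diameter (with_proj flag_graph) = ereal (real 4)"
    using x 0 \<open>x \<noteq> 0\<close> flag_dist_le_4
    by (intro descending_distance.graph_diameter_eq[OF descending_distance_flag_graph, of 4 "pt x" "fl 0 0"])
      auto
  then show ?thesis by simp
qed

lemma flag_graph_regular: "regular_graph (with_proj flag_graph)"
proof -
  have "out_degree (with_proj flag_graph) v = n + 1" if "v \<in> pverts flag_graph" for v
    using that
  proof (cases rule: verts_cases)
    case (pt x)
    have "out_arcs (with_proj flag_graph) v = (\<lambda>l. (v, fl x l)) ` {l. on x l}"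
      by (auto simp: out_arcs_def pt arcs_iff)
    then show ?thesis
      unfolding out_degree_def using card_pencil[OF pt(2)] by (simp add: card_image inj_on_def)
  next
    case (fl x l)
      have "out_arcs (with_proj flag_graph) v = insert (v, pt x) ((\<lambda>y. (v, fl y l)) ` ({y. on y l} - {x}))"
      using fl by (auto simp: out_arcs_def arcs_iff)
    moreover have "card ((\<lambda>y. (v, fl y l)) ` ({y. on y l} - {x})) = n"
      using fl finite_line card_line[of l] on_bounds(2)[of x l] by (simp add: card_image inj_on_def)
    ultimately show ?thesis
      unfolding out_degree_def using finite_line by (auto simp: card_insert_if)
  qed
  then show ?thesis by (auto simp: regular_graph_def)
qed

lemma card_verts: "card (pverts flag_graph) = N * (n + 2)"
proof -
  have flags: "{fl x l | x l. on x l} = (\<lambda>(l, x). fl x l) ` (SIGMA l:{..<N}. {x. on x l})"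
    using on_bounds(2) by auto
  have "card {fl x l | x l. on x l} = (\<Sum>l<N. card {x. on x l})"
    unfolding flags using finite_line by (subst card_image) (auto simp: inj_on_def)
  also have "\<dots> = N * (n + 1)"
    by (simp add: card_line)
  finally have *: "card {fl x l | x l. on x l} = N * (n + 1)" .
  have "card (pverts flag_graph) = card (pt ` {..<N}) + card {fl x l | x l. on x l}"
    unfolding flag_graph_def pair_pre_digraph.simps using finite_line
    by (intro card_Un_disjoint) (auto simp: flags)
  also have "\<dots> = N * (n + 2)"
    unfolding * by (simp add: card_image inj_on_def)
  finally show ?thesis .
qed

text \<open>
  The part of the Hamiltonian cycle between the points \<open>i\<close> and \<open>i + 1\<close>: all flags of line \<open>i\<close>,
  starting at the flag of point \<open>i\<close> and ending at the flag of point \<open>i + 1\<close>.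
\<close>

definition segment :: "nat \<Rightarrow> nat list" where
  "segment i = pt i # map (\<lambda>x. fl x i)
     (i # sorted_list_of_set ({x. on x i} - {i, Suc i mod N}) @ [Suc i mod N])"

lemma segment:
  assumes "i < N"
  shows "segment i \<noteq> []" "hd (segment i) = pt i" "last (segment i) = fl (Suc i mod N) i"
    "set (segment i) = insert (pt i) ((\<lambda>x. fl x i) ` {x. on x i})"
    "length (segment i) = n + 2"
    "successively (\<lambda>x y. (x, y) \<in> parcs flag_graph) (segment i)"
proof -
  let ?A = "{x. on x i}"
  define ys where "ys = i # sorted_list_of_set (?A - {i, Suc i mod N}) @ [Suc i mod N]"
  have seg: "segment i = pt i # map (\<lambda>x. fl x i) ys"
    by (simp add: segment_def ys_def)
  note fin = finite_line[of i]
  \<comment> \<open>The entry and exit points of the line must differ for its flags to be listed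
    without repetition.\<close>
  have ne: "i \<noteq> Suc i mod N"
    using assms order_bounds by (cases "Suc i = N") auto
  have dist: "distinct ys" and set: "set ys = ?A"
    using fin ne on_self[OF assms] on_next[OF assms] by (auto simp: ys_def)
  show "segment i \<noteq> []" "hd (segment i) = pt i" "set (segment i) = insert (pt i) ((\<lambda>x. fl x i) ` ?A)"
    using set by (auto simp: seg)
  show "last (segment i) = fl (Suc i mod N) i"
    by (simp add: segment_def)
  show "length (segment i) = n + 2"
    using distinct_card[OF dist] set card_line[OF assms] by (simp add: seg)
  \<comment> \<open>The flags of one line form a clique, so any order of distinct flags is a
    path.\<close>
  have "successively (\<lambda>x y. (x, y) \<in> parcs flag_graph) (map (\<lambda>x. fl x i) zs)"
    if "distinct zs" "set zs \<subseteq> ?A" for zs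
    using that by (induction zs rule: induct_list012) (auto simp: arcs_iff)
  from this[OF dist] have "successively (\<lambda>x y. (x, y) \<in> parcs flag_graph) (map (\<lambda>x. fl x i) ys)"
    using set by simp
  moreover have "ys \<noteq> []" "hd (map (\<lambda>x. fl x i) ys) = fl i i"
    by (simp_all add: ys_def)
  ultimately show "successively (\<lambda>x y. (x, y) \<in> parcs flag_graph) (segment i)"
    using on_self[OF assms] by (simp add: seg successively_Cons arcs_iff)
qed

lemma flag_graph_hamiltonian: "hamiltonian_graph (with_proj flag_graph)"
proof -
  define vs where "vs = concat (map segment [0..<N])"
  have "map length (map segment [0..<N]) = map (\<lambda>_. n + 2) [0..<N]"
    by (simp add: segment(5))
  then have len: "length vs = N * (n + 2)"
    unfolding vs_def length_concat by (simp only: sum_list_triv length_upt) simp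
  have "set vs = (\<Union>i<N. insert (pt i) ((\<lambda>x. fl x i) ` {x. on x i}))"
    by (auto simp: vs_def segment(4))
  also have "\<dots> = pverts flag_graph"
    using on_bounds(2) by (auto simp: flag_graph_def)
  finally have set: "set vs = pverts flag_graph" .
  \<comment> \<open>By counting: the list is as long as the number of vertices it covers.\<close>
  have dist: "distinct vs"
    by (rule card_distinct) (simp add: set card_verts len)
  \<comment> \<open>Nonempty initial parts, for an induction that glues the segments: the last flag
    of segment \<open>m\<close> belongs to the point that opens the next one.\<close>
  define C where "C m = concat (map segment [0..<Suc m])" for m
  have C_simps: "C 0 = segment 0" "C (Suc m) = C m @ segment (Suc m)" for m
    by (simp_all add: C_def)
  have C: "C m \<noteq> [] \<and> hd (C m) = pt 0 \<and> last (C m) = fl (Suc m mod N) m \<and>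
      successively (\<lambda>x y. (x, y) \<in> parcs flag_graph) (C m)" if "m < N" for m
    using that
  proof (induction m)
    case 0
    then show ?case using segment[of 0] by (simp add: C_simps)
  next
    case (Suc m)
    have "on (Suc m) m"
      using on_next[of m] Suc.prems by simp
    then have "(fl (Suc m) m, pt (Suc m)) \<in> parcs flag_graph"
      by (simp add: arcs_iff)
    then show ?case
      using Suc segment[of "Suc m"] by (simp add: C_simps successively_append_iff)
  qed
  \<comment> \<open>The exit point of the last line is \<open>N mod N = 0\<close>, which closes the
    cycle.\<close>
  have "Suc (N - 1) = N" using order_bounds by simp
  then have "vs = C (N - 1)" by (simp only: vs_def C_def)
  then have "hd vs = pt 0" "last vs = fl 0 (N - 1)"
    "successively (\<lambda>x y. (x, y) \<in> parcs flag_graph) vs"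
    using C[of "N - 1"] \<open>Suc (N - 1) = N\<close> order_bounds by auto
  moreover have "on 0 (N - 1)"
    using on_next[of "N - 1"] \<open>Suc (N - 1) = N\<close> by auto
  then have "(fl 0 (N - 1), pt 0) \<in> parcs flag_graph"
    by (simp add: arcs_iff)
  moreover have "3 \<le> length vs"
    unfolding len using order_bounds by (simp add: algebra_simps)
  ultimately show ?thesis
    using dist set pair_graph_flag_graph
    by (intro pair_wf_digraph.hamiltonian_if_cyclic_list[of flag_graph vs])
      (auto simp: pair_graph_def pair_digraph_def pair_fin_digraph_def)
qed

end

theorem theorem3:
  fixes n :: nat
  assumes "primepow n"
  shows "\<exists>G :: nat pair_pre_digraph. pair_graph G \<and>
           regular_graph (with_proj G) \<and>
           geodetic_graph (with_proj G) \<and>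
           hamiltonian_graph (with_proj G) \<and>
           graph_diameter (with_proj G) = 4 \<and>
           card (pverts G) = (n + 1) ^ 3 + 1"
proof -
  obtain on where "cyclic_plane n (n\<^sup>2 + n + 1) on"
    using cyclic_plane_exists[OF assms] .
  then interpret cyclic_plane n "n\<^sup>2 + n + 1" on .
  have "(n\<^sup>2 + n + 1) * (n + 2) = (n + 1) ^ 3 + 1"
    by (simp add: power2_eq_square power3_eq_cube algebra_simps)
  then show ?thesis
    using pair_graph_flag_graph flag_graph_regular descending_distance.geodetic[OF descending_distance_flag_graph] flag_graph_hamiltonian
      flag_graph_diameter card_verts by metis
qed

end
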